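(* Let $c=\sqrt{\sqrt{2}+1}$ (so $c\ge 1.55$). For all sufficiently large $n$, $$|T(\mathcal{G}_{\mathrm{all}}(n))|\ \ge\ |T(\mathcal{G}_{\mathrm{pla}}(n))|\ \ge\ 0.9\,c^n .$$
   Context: All graphs are simple. For a graph $G$, $\tau(G)$ denotes the number of spanning trees of $G$. $\mathcal{G}_{\mathrm{all}}(n)$ denotes the family of all (simple) graphs on $n$ vertices and $\mathcal{G}_{\mathrm{pla}}(n)$ the family of all (simple) planar graphs on $n$ vertices. For a family $\mathcal{G}$ of graphs, its tree spectrum is $T(\mathcal{G}):=\{\tau(G): G\in\mathcal{G}\}$. *)

theory Defs
  imports "HOL-Analysis.Analysis"
begin

type_synonym 'a ugraph = "'a set \<times> 'a set set"

abbreviation verts :: "'a ugraph \<Rightarrow> 'a set" where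
  "verts G \<equiv> fst G"

abbreviation edges :: "'a ugraph \<Rightarrow> 'a set set" where
  "edges G \<equiv> snd G"

definition simple_graph :: "'a ugraph \<Rightarrow> bool" where
  "simple_graph G \<longleftrightarrow> finite (verts G) \<and> (\<forall>e\<in>edges G. e \<subseteq> verts G \<and> card e = 2)"

definition connected_graph :: "'a ugraph \<Rightarrow> bool" where
  "connected_graph G \<longleftrightarrow> verts G \<noteq> {} \<and>
     (\<forall>u\<in>verts G. \<forall>v\<in>verts G. (u, v) \<in> {(x, y). {x, y} \<in> edges G}\<^sup>*)"

text \<open>A cycle is given by the list of its vertices in cyclic order, without repeating the first.\<close>

definition is_cycle :: "'a ugraph \<Rightarrow> 'a list \<Rightarrow> bool" where
  "is_cycle G xs \<longleftrightarrow> length xs \<ge> 3 \<and> distinct xs \<and>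
     (\<forall>i<length xs. {xs ! i, xs ! (Suc i mod length xs)} \<in> edges G)"

definition tree :: "'a ugraph \<Rightarrow> bool" where
  "tree G \<longleftrightarrow> simple_graph G \<and> connected_graph G \<and> (\<nexists>xs. is_cycle G xs)"

definition spanning_trees :: "'a ugraph \<Rightarrow> 'a ugraph set" where
  "spanning_trees G = {H. tree H \<and> verts H = verts G \<and> edges H \<subseteq> edges G}"

definition num_spanning_trees :: "'a ugraph \<Rightarrow> nat" (\<open>\<tau>\<close>) where
  "\<tau> G = card (spanning_trees G)"

text \<open>
  A drawing in the plane sends vertices to distinct points and every edge to a simple arc
  joining its two ends; an arc contains no vertices other than its ends, and two
  arcs meet only in common ends.
\<close>

definition plane_drawing ::
    "'a ugraph \<Rightarrow> ('a \<Rightarrow> real \<times> real) \<Rightarrow> ('a set \<Rightarrow> real \<Rightarrow> real \<times> real) \<Rightarrow> bool" where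
  "plane_drawing G p \<gamma> \<longleftrightarrow>
     inj_on p (verts G) \<and>
     (\<forall>e\<in>edges G. arc (\<gamma> e) \<and> {pathstart (\<gamma> e), pathfinish (\<gamma> e)} = p ` e \<and>
        path_image (\<gamma> e) \<inter> p ` verts G = p ` e) \<and>
     (\<forall>e\<in>edges G. \<forall>f\<in>edges G. e \<noteq> f \<longrightarrow>
        path_image (\<gamma> e) \<inter> path_image (\<gamma> f) = p ` (e \<inter> f))"

definition planar :: "'a ugraph \<Rightarrow> bool" where
  "planar G \<longleftrightarrow> (\<exists>p \<gamma>. plane_drawing G p \<gamma>)"

text \<open>Every finite graph is isomorphic to one whose vertices are natural numbers.\<close>

definition graphs_all :: "nat \<Rightarrow> nat ugraph set" where
  "graphs_all n = {G. simple_graph G \<and> card (verts G) = n}"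

definition graphs_pla :: "nat \<Rightarrow> nat ugraph set" where
  "graphs_pla n = {G \<in> graphs_all n. planar G}"

definition tree_spectrum :: "'a ugraph set \<Rightarrow> nat set" where
  "tree_spectrum \<G> = {\<tau> G | G. G \<in> \<G>}"

end

theory Submission
  imports Defs
begin

text \<open>
  For a two-terminal network let \<open>t\<close> be the number of its spanning trees and \<open>f\<close> the number of spanning
  trees after identifying the terminals. A series edge maps \<open>(t, f)\<close> to \<open>(t, t + f)\<close>, a parallel edge to
  \<open>(t + f, f)\<close> and a parallel path of length two to \<open>(2t + f, 2f)\<close>. If the terminals are not adjacent,
  then \<open>t\<close> and \<open>t + f\<close> are both numbers of spanning trees of simple graphs on the same \<open>n\<close> vertices, so the
  number of pairs \<open>(t, f)\<close> that occur is at most the square of the size of the spectrum.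

  Combining the operations gives eight maps that add \<open>1\<close>, \<open>2\<close>, \<open>2\<close>, \<open>3\<close>, \<open>3\<close>, \<open>3\<close>, \<open>4\<close>, \<open>4\<close> vertices
  and act on the conductance \<open>t / f\<close> as injective maps of \<open>[1/2, 3/4)\<close> with disjoint images. Hence the number
  \<open>a n\<close> of pairs satisfies \<open>a (n + 4) = a (n + 3) + 2 a (n + 2) + 3 a (n + 1) + 2 a n\<close>, whose growth
  rate is strictly larger than \<open>1 + sqrt 2\<close>; this absorbs all constants.
\<close>

section \<open>Trees, pendant edges and subdivisions\<close>

abbreviation adj :: "'a set set \<Rightarrow> ('a \<times> 'a) set" where
  "adj E \<equiv> {(x, y). {x, y} \<in> E}"

text \<open>The typical map is \<open>id(w := u)\<close>, which merges a vertex \<open>w\<close>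
  into its neighbour \<open>u\<close> and collapses the edge \<open>{w, u}\<close> to an empty
  walk.\<close>

lemma rtrancl_map_into:
  assumes "(a, b) \<in> R\<^sup>*" and "\<And>x y. (x, y) \<in> R \<Longrightarrow> (\<phi> x, \<phi> y) \<in> R'\<^sup>*"
  shows "(\<phi> a, \<phi> b) \<in> R'\<^sup>*"
  using assms(1) by induction (auto intro: rtrancl_trans assms(2))

lemma adj_rtrancl_sym: "(x, y) \<in> (adj E)\<^sup>* \<Longrightarrow> (y, x) \<in> (adj E)\<^sup>*"
proof -
  have "sym (adj E)"
    by (auto simp: sym_def insert_commute)
  then show "(x, y) \<in> (adj E)\<^sup>* \<Longrightarrow> (y, x) \<in> (adj E)\<^sup>*"
    by (meson sym_rtrancl symD)
qed

lemma adj_rtrancl_doubleton: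
  assumes "{a, b} = {c, d}"
  shows "(a, b) \<in> (adj E)\<^sup>* \<longleftrightarrow> (c, d) \<in> (adj E)\<^sup>*"
  using assms adj_rtrancl_sym[of a b E] adj_rtrancl_sym[of b a E] unfolding doubleton_eq_iff
  by (elim disjE conjE) blast+

lemma adj_rtrancl_via:
  "(a, u) \<in> (adj E)\<^sup>* \<Longrightarrow> (b, u) \<in> (adj E)\<^sup>* \<Longrightarrow> (a, b) \<in> (adj E)\<^sup>*"
  using adj_rtrancl_sym rtrancl_trans by fastforce

lemma adj_rtrancl_mono: "(x, y) \<in> (adj E)\<^sup>* \<Longrightarrow> E \<subseteq> F \<Longrightarrow> (x, y) \<in> (adj F)\<^sup>*"
  by (erule rtrancl_mono[THEN subsetD, rotated]) auto

lemma rtrancl_distinct_path: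
  assumes "(x, y) \<in> r\<^sup>*"
  shows "\<exists>xs. xs \<noteq> [] \<and> hd xs = x \<and> last xs = y \<and> distinct xs \<and>
    (\<forall>i. Suc i < length xs \<longrightarrow> (xs ! i, xs ! Suc i) \<in> r)"
  using assms
proof induction
  case base
  show ?case by (rule exI[of _ "[x]"]) simp
next
  case (step y z)
  then obtain xs where xs: "xs \<noteq> []" "hd xs = x" "last xs = y" "distinct xs"
    "\<forall>i. Suc i < length xs \<longrightarrow> (xs ! i, xs ! Suc i) \<in> r" by auto
  show ?case
  proof (cases "z \<in> set xs")
    case True
    \<comment> \<open>The walk returns to a vertex of the path, so the path is cut at that
      vertex.\<close>
    then obtain i where i: "i < length xs" "xs ! i = z" by (auto simp: in_set_conv_nth)
    then have "length xs - Suc 0 = i" if "length xs \<le> Suc i" using that by simp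
    then show ?thesis
      using xs i by (intro exI[of _ "take (Suc i) xs"])
        (auto simp: last_conv_nth hd_conv_nth min_def)
  next
    case False
    have "(\<forall>i. Suc i < length (xs @ [z]) \<longrightarrow> ((xs @ [z]) ! i, (xs @ [z]) ! Suc i) \<in> r)"
    proof (intro allI impI)
      fix i assume "Suc i < length (xs @ [z])"
      then consider "Suc i < length xs" | "Suc i = length xs" by fastforce
      then show "((xs @ [z]) ! i, (xs @ [z]) ! Suc i) \<in> r"
      proof cases
        case 2
        then have "i = length xs - 1" by simp
        then have "xs ! i = y" using xs(1,3) by (simp add: last_conv_nth)
        then show ?thesis using 2 step(2) by (simp add: nth_append)
      qed (use xs(5) in \<open>simp add: nth_append\<close>)
    qed
    then show ?thesis using xs False by (intro exI[of _ "xs @ [z]"]) auto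
  qed
qed

text \<open>A second route between the ends of an edge closes up with it to a cycle, and a cycle
  minus an edge still joins the ends of that edge. Acyclicity thus becomes a statement on
  reachability, which vertex maps transport.\<close>

lemma no_cycle_iff_bridges:
  assumes "simple_graph (V, E)"
  shows "(\<nexists>xs. is_cycle (V, E) xs) \<longleftrightarrow>
    (\<forall>x y. {x, y} \<in> E \<longrightarrow> (x, y) \<notin> (adj (E - {{x, y}}))\<^sup>*)"
proof (intro iffI allI impI notI)
  fix x y
  assume no: "\<nexists>xs. is_cycle (V, E) xs" and e: "{x, y} \<in> E"
    and p: "(x, y) \<in> (adj (E - {{x, y}}))\<^sup>*"
  have ne: "x \<noteq> y" using assms e by (auto simp: simple_graph_def)
  obtain xs where xs: "xs \<noteq> []" "hd xs = x" "last xs = y" "distinct xs"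
    "\<And>i. Suc i < length xs \<Longrightarrow> (xs ! i, xs ! Suc i) \<in> adj (E - {{x, y}})"
    using rtrancl_distinct_path[OF p] by blast
  have x0: "xs ! 0 = x" and xl: "xs ! (length xs - 1) = y"
    using xs by (auto simp: hd_conv_nth last_conv_nth)
  have l1: "length xs \<noteq> 1" using x0 xl ne by auto
  moreover have "length xs \<noteq> 2"
  proof
    assume "length xs = 2"
    then show False using xs(5)[of 0] x0 xl by (simp add: numeral_2_eq_2)
  qed
  ultimately have l3: "length xs \<ge> 3" using xs(1)
    by (metis One_nat_def Suc_1 length_0_conv less_2_cases_iff not_less not_less_eq_eq
        numeral_3_eq_3 less_Suc_eq_le le_antisym)
  have "is_cycle (V, E) xs"
    unfolding is_cycle_def
  proof (intro conjI allI impI)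
    fix i assume i: "i < length xs"
    show "{xs ! i, xs ! (Suc i mod length xs)} \<in> edges (V, E)"
    proof (cases "Suc i < length xs")
      case True
      then show ?thesis using xs(5)[of i] by simp
    next
      case False
      then have "Suc i = length xs" using i by simp
      moreover from this have "xs ! i = y" using xl by (metis diff_Suc_1)
      ultimately show ?thesis using x0 e by (simp add: insert_commute)
    qed
  qed (use l3 xs in auto)
  then show False using no by blast
next
  fix xs
  assume br: "\<forall>x y. {x, y} \<in> E \<longrightarrow> (x, y) \<notin> (adj (E - {{x, y}}))\<^sup>*"
  assume "\<exists>xs. is_cycle (V, E) xs"
  then obtain xs where c: "is_cycle (V, E) xs" by blast
  define n where "n = length xs"
  have n: "n \<ge> 3" "distinct xs" and ed: "\<And>i. i < n \<Longrightarrow> {xs ! i, xs ! (Suc i mod n)} \<in> E"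
    using c by (auto simp: is_cycle_def n_def)
  then have "xs \<noteq> []" by (auto simp: n_def)
  let ?e = "{xs ! 0, xs ! (n - 1)}"
  have eE: "?e \<in> E" using ed[of "n - 1"] n by (simp add: insert_commute)
  have "(xs ! 0, xs ! i) \<in> (adj (E - {?e}))\<^sup>*" if "i < n" for i
    using that
  proof (induction i)
    case (Suc i)
    have "{xs ! i, xs ! Suc i} \<in> E" using ed[of i] Suc.prems by simp
    \<comment> \<open>By distinctness only \<open>i = 0\<close> with \<open>Suc i = n - 1\<close>
      could give the closing edge, and \<open>n \<ge> 3\<close> excludes this.\<close>
    moreover have "{xs ! i, xs ! Suc i} \<noteq> ?e"
    proof
      assume "{xs ! i, xs ! Suc i} = ?e"
      then consider "xs ! i = xs ! 0" "xs ! Suc i = xs ! (n - 1)" | "xs ! Suc i = xs ! 0"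
        by (auto simp: doubleton_eq_iff)
      then show False
        by cases (use n Suc.prems nth_eq_iff_index_eq[of xs i 0] nth_eq_iff_index_eq[of xs "Suc i" 0]
            nth_eq_iff_index_eq[of xs "Suc i" "n - 1"] \<open>xs \<noteq> []\<close> in \<open>auto simp: n_def\<close>)
    qed
    ultimately show ?case using Suc by (auto intro: rtrancl_into_rtrancl)
  qed simp
  from this[of "n - 1"] show False using br eE n by auto
qed

lemma tree_iff:
  "tree (V, E) \<longleftrightarrow> simple_graph (V, E) \<and> V \<noteq> {} \<and> (\<forall>u\<in>V. \<forall>v\<in>V. (u, v) \<in> (adj E)\<^sup>*) \<and>
     (\<forall>x y. {x, y} \<in> E \<longrightarrow> (x, y) \<notin> (adj (E - {{x, y}}))\<^sup>*)"
  using no_cycle_iff_bridges[of V E] by (auto simp: tree_def connected_graph_def)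

text \<open>A walk visits a pendant vertex only to turn back, so contracting \<open>w\<close> into
  \<open>u\<close> leaves a walk in \<open>F\<close>.\<close>

lemma adj_rtrancl_pendant_iff:
  assumes "w \<notin> \<Union>F" "a \<noteq> w" "b \<noteq> w" "u \<noteq> w"
  shows "(a, b) \<in> (adj (insert {w, u} F))\<^sup>* \<longleftrightarrow> (a, b) \<in> (adj F)\<^sup>*"
proof
  assume "(a, b) \<in> (adj (insert {w, u} F))\<^sup>*"
  then have "((id(w := u)) a, (id(w := u)) b) \<in> (adj F)\<^sup>*"
    by (rule rtrancl_map_into) (use assms in \<open>auto simp: doubleton_eq_iff intro!: r_into_rtrancl\<close>)
  then show "(a, b) \<in> (adj F)\<^sup>*" using assms by simp
qed (erule adj_rtrancl_mono, blast)

lemma adj_rtrancl_isolated: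
  assumes "(a, b) \<in> (adj F)\<^sup>*" "a \<notin> \<Union>F"
  shows "b = a"
  using assms by induction auto

lemma simple_graph_pendant_iff:
  assumes "w \<notin> V" "u \<in> V" "\<Union>F \<subseteq> V"
  shows "simple_graph (insert w V, insert {w, u} F) \<longleftrightarrow> simple_graph (V, F)"
  using assms by (auto simp: simple_graph_def card_2_iff)

text \<open>The pendant edge changes no reachability inside \<open>V\<close>, so connectedness and
  the old bridges survive; the new edge is a bridge because \<open>w\<close> is isolated without
  it.\<close>

lemma tree_pendant_iff:
  assumes w: "w \<notin> V" and u: "u \<in> V" and F: "\<Union>F \<subseteq> V"
  shows "tree (insert w V, insert {w, u} F) \<longleftrightarrow> tree (V, F)" (is "?L \<longleftrightarrow> ?R")
proof -
  let ?F = "insert {w, u} F"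
  have wF: "w \<notin> \<Union>F" and wu: "u \<noteq> w" and nF: "{w, u} \<notin> F" using assms by auto
  have pen: "(a, b) \<in> (adj ?F)\<^sup>* \<longleftrightarrow> (a, b) \<in> (adj F)\<^sup>*" if "a \<in> V" "b \<in> V" for a b
    by (rule adj_rtrancl_pendant_iff) (use that w wF wu in auto)
  have wu1: "(w, u) \<in> (adj ?F)\<^sup>*" by auto
  have conn: "(\<forall>a\<in>insert w V. \<forall>b\<in>insert w V. (a, b) \<in> (adj ?F)\<^sup>*) \<longleftrightarrow>
      (\<forall>a\<in>V. \<forall>b\<in>V. (a, b) \<in> (adj F)\<^sup>*)" (is "?A \<longleftrightarrow> ?B")
  proof
    assume B: ?B
    have au: "(a, u) \<in> (adj ?F)\<^sup>*" if "a \<in> insert w V" for a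
      using that B u pen wu1 by auto
    show ?A using adj_rtrancl_via[OF au au] by blast
  qed (use pen in auto)
  have br: "(a, b) \<in> (adj (?F - {{a, b}}))\<^sup>* \<longleftrightarrow> (a, b) \<in> (adj (F - {{a, b}}))\<^sup>*"
    if "{a, b} \<in> F" for a b
  proof -
    have "?F - {{a, b}} = insert {w, u} (F - {{a, b}})" using that nF by auto
    then show ?thesis
      using adj_rtrancl_pendant_iff[of w "F - {{a, b}}" a b u] that wF wu by auto
  qed
  have new: "(a, b) \<notin> (adj (?F - {{a, b}}))\<^sup>*" if ab: "{a, b} = {w, u}" for a b
  proof
    assume "(a, b) \<in> (adj (?F - {{a, b}}))\<^sup>*"
    moreover have "?F - {{a, b}} = F" using nF ab by auto
    ultimately have "(w, u) \<in> (adj F)\<^sup>*"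
      using adj_rtrancl_doubleton[OF ab] by simp
    then show False using adj_rtrancl_isolated[of w u F] wF wu by auto
  qed
  have brF: "(\<forall>a b. {a, b} \<in> ?F \<longrightarrow> (a, b) \<notin> (adj (?F - {{a, b}}))\<^sup>*) \<longleftrightarrow>
    (\<forall>a b. {a, b} \<in> F \<longrightarrow> (a, b) \<notin> (adj (F - {{a, b}}))\<^sup>*)"
    (is "?P \<longleftrightarrow> ?Q")
  proof
    show ?Q if ?P
    proof (intro allI impI)
      fix a b assume ab: "{a, b} \<in> F"
      then have "{a, b} \<in> ?F" by (rule insertI2)
      with that have "(a, b) \<notin> (adj (?F - {{a, b}}))\<^sup>*" by blast
      then show "(a, b) \<notin> (adj (F - {{a, b}}))\<^sup>*" unfolding br[OF ab] .
    qed
    show ?P if ?Q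
    proof (intro allI impI)
      fix a b assume "{a, b} \<in> ?F"
      then show "(a, b) \<notin> (adj (?F - {{a, b}}))\<^sup>*"
      proof (rule insertE)
        assume ab: "{a, b} \<in> F"
        then show ?thesis unfolding br[OF ab] using that by blast
      qed (rule new)
    qed
  qed
  have "V \<noteq> {}" using u by blast
  then show ?thesis
    unfolding tree_iff simple_graph_pendant_iff[OF assms] conn brF
    by (simp only: insert_not_empty simp_thms)
qed

text \<open>Contracting \<open>w\<close> into \<open>u\<close> turns \<open>{w, v}\<close> into
  \<open>{u, v}\<close>; conversely, a step along \<open>{u, v}\<close> becomes the detour through
  \<open>w\<close>.\<close>

lemma adj_rtrancl_subdivide_iff:
  assumes "w \<notin> \<Union>F" "a \<noteq> w" "b \<noteq> w" "u \<noteq> w" "v \<noteq> w"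
  shows "(a, b) \<in> (adj (insert {w, u} (insert {w, v} F)))\<^sup>* \<longleftrightarrow>
    (a, b) \<in> (adj (insert {u, v} F))\<^sup>*"
proof
  assume "(a, b) \<in> (adj (insert {w, u} (insert {w, v} F)))\<^sup>*"
  then have "((id(w := u)) a, (id(w := u)) b) \<in> (adj (insert {u, v} F))\<^sup>*"
    by (rule rtrancl_map_into)
       (use assms in \<open>auto simp: doubleton_eq_iff intro!: r_into_rtrancl\<close>)
  then show "(a, b) \<in> (adj (insert {u, v} F))\<^sup>*" using assms by simp
next
  let ?T = "insert {w, u} (insert {w, v} F)"
  assume ab: "(a, b) \<in> (adj (insert {u, v} F))\<^sup>*"
  have uv: "(u, v) \<in> (adj ?T)\<^sup>*"
    by (rule rtrancl_trans[of _ w]; rule r_into_rtrancl) (auto simp: insert_commute)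
  have "(id a, id b) \<in> (adj ?T)\<^sup>*"
    using ab
  proof (rule rtrancl_map_into)
    fix x y assume "(x, y) \<in> adj (insert {u, v} F)"
    then show "(id x, id y) \<in> (adj ?T)\<^sup>*"
      using uv adj_rtrancl_sym[OF uv] by (auto simp: doubleton_eq_iff)
  qed
  then show "(a, b) \<in> (adj ?T)\<^sup>*" by simp
qed

text \<open>If \<open>{u, v}\<close> lies in \<open>F\<close>, the path through \<open>w\<close>
  closes a triangle with it, although \<open>insert {u, v} F\<close> may still be a tree. Otherwise
  each of \<open>{w, u}\<close>, \<open>{w, v}\<close>, \<open>{u, v}\<close> is a bridge of its
  graph exactly when \<open>F\<close> does not connect \<open>u\<close> and
  \<open>v\<close>.\<close>

lemma tree_subdivide_iff:
  assumes w: "w \<notin> V" and u: "u \<in> V" and v: "v \<in> V" and uv: "u \<noteq> v" and F: "\<Union>F \<subseteq> V"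
  shows "tree (insert w V, insert {w, u} (insert {w, v} F)) \<longleftrightarrow>
    {u, v} \<notin> F \<and> tree (V, insert {u, v} F)" (is "tree (?W, ?T) \<longleftrightarrow> _ \<and> tree (_, ?U)")
proof (cases "{u, v} \<in> F")
  case True
  have wuv: "u \<noteq> w" "v \<noteq> w" using w u v by auto
  have "(u, v) \<in> (adj (?T - {{u, v}}))\<^sup>*"
    by (rule rtrancl_trans[of _ w]; rule r_into_rtrancl)
       (use wuv in \<open>auto simp: doubleton_eq_iff\<close>)
  then show ?thesis using True unfolding tree_iff by blast
next
  case False
  have wF: "w \<notin> \<Union>F" and wu: "u \<noteq> w" and wv: "v \<noteq> w"
    and nF: "{w, u} \<notin> F" "{w, v} \<notin> F" "{w, u} \<noteq> {w, v}"
    using assms by (auto simp: doubleton_eq_iff)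
  have sub: "(a, b) \<in> (adj ?T)\<^sup>* \<longleftrightarrow> (a, b) \<in> (adj ?U)\<^sup>*" if "a \<in> V" "b \<in> V" for a b
    by (rule adj_rtrancl_subdivide_iff) (use that w wF wu wv in auto)
  have wu1: "(w, u) \<in> (adj ?T)\<^sup>*" by auto
  have conn: "(\<forall>a\<in>?W. \<forall>b\<in>?W. (a, b) \<in> (adj ?T)\<^sup>*) \<longleftrightarrow>
      (\<forall>a\<in>V. \<forall>b\<in>V. (a, b) \<in> (adj ?U)\<^sup>*)" (is "?A \<longleftrightarrow> ?B")
  proof
    assume B: ?B
    have au: "(a, u) \<in> (adj ?T)\<^sup>*" if "a \<in> ?W" for a
      using that B u sub wu1 by auto
    show ?A using adj_rtrancl_via[OF au au] by blast
  qed (use sub in auto)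
  have old: "(a, b) \<in> (adj (?T - {{a, b}}))\<^sup>* \<longleftrightarrow> (a, b) \<in> (adj (?U - {{a, b}}))\<^sup>*"
    if "{a, b} \<in> F" for a b
  proof -
    have "{w, u} \<noteq> {a, b}" "{w, v} \<noteq> {a, b}" "{u, v} \<noteq> {a, b}" using that nF False by metis+
    then have "?T - {{a, b}} = insert {w, u} (insert {w, v} (F - {{a, b}}))"
      "?U - {{a, b}} = insert {u, v} (F - {{a, b}})"
      by (simp_all only: insert_Diff_if singleton_iff if_False)
    then show ?thesis
      using adj_rtrancl_subdivide_iff[of w "F - {{a, b}}" a b u v] that wF wu wv by fastforce
  qed
  \<comment> \<open>With one of the two new edges removed, \<open>w\<close> is pendant at the end
    \<open>z\<close> of the other, so \<open>w\<close> reaches \<open>s\<close> just when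
    \<open>z\<close> does in \<open>F\<close>.\<close>
  have key: "(x, y) \<in> (adj (insert {w, z} F))\<^sup>* \<longleftrightarrow> (z, s) \<in> (adj F)\<^sup>*"
    if "{x, y} = {w, s}" "s \<in> V" "z \<in> V" for x y z s
  proof -
    have zw: "(w, z) \<in> (adj (insert {w, z} F))\<^sup>*" by auto
    have "(x, y) \<in> (adj (insert {w, z} F))\<^sup>* \<longleftrightarrow> (w, s) \<in> (adj (insert {w, z} F))\<^sup>*"
      using that(1) by (rule adj_rtrancl_doubleton)
    also have "\<dots> \<longleftrightarrow> (z, s) \<in> (adj (insert {w, z} F))\<^sup>*"
      using rtrancl_trans[OF zw] rtrancl_trans[OF adj_rtrancl_sym[OF zw]] by blast
    also have "\<dots> \<longleftrightarrow> (z, s) \<in> (adj F)\<^sup>*"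
      by (rule adj_rtrancl_pendant_iff) (use that w wF in auto)
    finally show ?thesis .
  qed
  have new_u: "(a, b) \<in> (adj (?T - {{a, b}}))\<^sup>* \<longleftrightarrow> (v, u) \<in> (adj F)\<^sup>*"
    if "{a, b} = {w, u}" for a b
  proof -
    have "?T - {{a, b}} = insert {w, v} F" unfolding that using nF by blast
    then show ?thesis using key[OF that u v] by simp
  qed
  have new_v: "(a, b) \<in> (adj (?T - {{a, b}}))\<^sup>* \<longleftrightarrow> (u, v) \<in> (adj F)\<^sup>*"
    if "{a, b} = {w, v}" for a b
  proof -
    have "?T - {{a, b}} = insert {w, u} F" unfolding that using nF by blast
    then show ?thesis using key[OF that v u] by simp
  qed
  have new_uv: "(a, b) \<in> (adj (?U - {{a, b}}))\<^sup>* \<longleftrightarrow> (u, v) \<in> (adj F)\<^sup>*"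
    if "{a, b} = {u, v}" for a b
  proof -
    have "?U - {{a, b}} = F" unfolding that using False by blast
    then show ?thesis using adj_rtrancl_doubleton[OF that] by simp
  qed
  have sg: "simple_graph (?W, ?T) \<longleftrightarrow> simple_graph (V, ?U)"
    using assms by (auto simp: simple_graph_def card_2_iff)
  have brT: "(\<forall>a b. {a, b} \<in> ?T \<longrightarrow> (a, b) \<notin> (adj (?T - {{a, b}}))\<^sup>*) \<longleftrightarrow>
    (\<forall>a b. {a, b} \<in> F \<longrightarrow> (a, b) \<notin> (adj (?U - {{a, b}}))\<^sup>*) \<and> (u, v) \<notin> (adj F)\<^sup>*"
    (is "?P \<longleftrightarrow> ?Q")
  proof
    assume P: ?P
    have "{w, v} \<in> ?T" by (rule insertI2, rule insertI1)
    then have "(u, v) \<notin> (adj F)\<^sup>*" using P new_v[of w v] by blast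
    moreover have "(a, b) \<notin> (adj (?U - {{a, b}}))\<^sup>*" if ab: "{a, b} \<in> F" for a b
    proof -
      have "{a, b} \<in> ?T" using ab by (intro insertI2)
      with P have "(a, b) \<notin> (adj (?T - {{a, b}}))\<^sup>*" by blast
      then show ?thesis unfolding old[OF ab] .
    qed
    ultimately show ?Q by blast
  next
    assume Q: ?Q
    have vu: "(v, u) \<notin> (adj F)\<^sup>*" using Q adj_rtrancl_sym[of v u F] by blast
    show ?P
    proof (intro allI impI)
      fix a b assume "{a, b} \<in> ?T"
      then consider (u) "{a, b} = {w, u}" | (v) "{a, b} = {w, v}" | (F) "{a, b} \<in> F"
        unfolding insert_iff by argo
      then show "(a, b) \<notin> (adj (?T - {{a, b}}))\<^sup>*"
      proof cases
        case u
        show ?thesis unfolding new_u[OF u] by (rule vu)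
      next
        case v
        then show ?thesis unfolding new_v[OF v] using Q by blast
      next
        case F
        then show ?thesis unfolding old[OF F] using Q by blast
      qed
    qed
  qed
  have brU: "(\<forall>a b. {a, b} \<in> ?U \<longrightarrow> (a, b) \<notin> (adj (?U - {{a, b}}))\<^sup>*) \<longleftrightarrow>
    (\<forall>a b. {a, b} \<in> F \<longrightarrow> (a, b) \<notin> (adj (?U - {{a, b}}))\<^sup>*) \<and> (u, v) \<notin> (adj F)\<^sup>*"
    (is "?P' \<longleftrightarrow> ?Q")
  proof
    assume P: ?P'
    have "(u, v) \<notin> (adj F)\<^sup>*" using P new_uv[of u v] by blast
    then show ?Q using P by blast
  next
    assume Q: ?Q
    show ?P'
    proof (intro allI impI)
      fix a b assume "{a, b} \<in> ?U"
      then show "(a, b) \<notin> (adj (?U - {{a, b}}))\<^sup>*"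
      proof (rule insertE)
        assume ab: "{a, b} = {u, v}"
        show ?thesis unfolding new_uv[OF ab] using Q by blast
      qed (use Q in blast)
    qed
  qed
  have "V \<noteq> {}" using u by blast
  then show ?thesis
    unfolding tree_iff sg conn brT brU by (simp only: insert_not_empty False simp_thms)
qed

section \<open>Counting spanning trees under series and parallel operations\<close>

definition tree_sets :: "'a set \<Rightarrow> 'a set set \<Rightarrow> 'a set set set" where
  "tree_sets V E = {T. T \<subseteq> E \<and> tree (V, T)}"

text \<open>
  Contracting \<open>e = {u, v}\<close> turns these trees into the spanning trees of the graph with \<open>u\<close> and \<open>v\<close>
  identified; \<open>e\<close> may or may not be an edge of the graph.
\<close>

definition trees_through :: "'a set \<Rightarrow> 'a set set \<Rightarrow> 'a set \<Rightarrow> 'a set set set" where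
  "trees_through V E e = {T \<in> tree_sets V (insert e E). e \<in> T}"

lemma num_spanning_trees_eq_card_tree_sets: "\<tau> (V, E) = card (tree_sets V E)"
proof -
  have "spanning_trees (V, E) = Pair V ` tree_sets V E"
    by (auto simp: spanning_trees_def tree_sets_def)
  then show ?thesis by (simp add: num_spanning_trees_def card_image inj_on_def)
qed

lemma finite_tree_sets: "finite E \<Longrightarrow> finite (tree_sets V E)"
  by (rule finite_subset[of _ "Pow E"]) (auto simp: tree_sets_def)

lemma finite_trees_through: "finite E \<Longrightarrow> finite (trees_through V E e)"
  by (simp add: trees_through_def finite_tree_sets)

lemma card_image_insert: "(\<And>T. T \<in> X \<Longrightarrow> e \<notin> T) \<Longrightarrow> card (insert e ` X) = card X"
  by (intro card_image inj_onI) (simp add: insert_ident)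

lemma not_tree_isolated:
  assumes "w \<notin> V" "u \<in> V" "\<Union>T \<subseteq> V"
  shows "\<not> tree (insert w V, T)"
proof
  assume "tree (insert w V, T)"
  then have "(w, u) \<in> (adj T)\<^sup>*" using assms(2) unfolding tree_iff by blast
  then have "u = w" using assms(1,3) by (intro adj_rtrancl_isolated) auto
  then show False using assms by simp
qed

text \<open>A spanning tree has to reach \<open>w\<close>, hence uses the only edge there.\<close>

lemma tree_sets_pendant:
  assumes w: "w \<notin> V" and u: "u \<in> V" and E: "\<Union>E \<subseteq> V"
  shows "tree_sets (insert w V) (insert {w, u} E) = insert {w, u} ` tree_sets V E"
proof (intro equalityI subsetI)
  fix T assume "T \<in> tree_sets (insert w V) (insert {w, u} E)"
  then have T: "T \<subseteq> insert {w, u} E" "tree (insert w V, T)" by (auto simp: tree_sets_def)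
  have wT: "{w, u} \<in> T"
  proof (rule ccontr)
    assume "{w, u} \<notin> T"
    then have "\<Union>T \<subseteq> V" using T(1) E by blast
    from not_tree_isolated[OF w u this] T(2) show False by (rule notE)
  qed
  let ?S = "T - {{w, u}}"
  have S: "T = insert {w, u} ?S" "?S \<subseteq> E"
    using wT T(1) by (simp add: insert_absorb) (use T(1) in blast)
  then have "\<Union>?S \<subseteq> V" using E by blast
  then have "tree (V, ?S)" using T(2) S(1) tree_pendant_iff[OF w u] by metis
  with S(2) have "?S \<in> tree_sets V E" by (simp add: tree_sets_def)
  then show "T \<in> insert {w, u} ` tree_sets V E" using S(1) by blast
next
  fix T assume "T \<in> insert {w, u} ` tree_sets V E"
  then obtain S where S: "T = insert {w, u} S" "S \<subseteq> E" "tree (V, S)"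
    by (auto simp: tree_sets_def)
  then have "\<Union>S \<subseteq> V" using E by blast
  from tree_pendant_iff[OF w u this] S
  show "T \<in> tree_sets (insert w V) (insert {w, u} E)"
    unfolding tree_sets_def by blast
qed

text \<open>The trees are sorted by the edges they use at \<open>w\<close>: with one edge
  \<open>w\<close> is a leaf of the tree; with both, the path through \<open>w\<close> subdivides
  the edge \<open>{u, v}\<close> of a tree on \<open>V\<close>.\<close>

lemma tree_sets_insert_vertex2:
  assumes w: "w \<notin> V" and u: "u \<in> V" and v: "v \<in> V" and uv: "u \<noteq> v" and E: "\<Union>E \<subseteq> V"
  shows "tree_sets (insert w V) (insert {w, u} (insert {w, v} E)) =
    insert {w, u} ` tree_sets V E \<union> insert {w, v} ` tree_sets V E \<union>
    (\<lambda>T. insert {w, u} (insert {w, v} (T - {{u, v}}))) ` trees_through V E {u, v}"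
    (is "?L = ?A \<union> ?B \<union> ?C")
proof -
  have L: "T \<in> ?A \<union> ?B \<union> ?C" if "T \<in> ?L" for T
  proof -
    have T: "T \<subseteq> insert {w, u} (insert {w, v} E)" "tree (insert w V, T)"
      using that by (auto simp: tree_sets_def)
    let ?S = "T - {{w, u}, {w, v}}"
    have SE: "?S \<subseteq> E" using T(1) by blast
    then have SV: "\<Union>?S \<subseteq> V" using E by blast
    consider "{w, u} \<notin> T" "{w, v} \<notin> T" | "{w, v} \<notin> T" | "{w, u} \<notin> T" | "{w, u} \<in> T" "{w, v} \<in> T"
      by blast
    then show ?thesis
    proof cases
      case 1
      then have "?S = T" by blast
      then show ?thesis using not_tree_isolated[OF w u SV] T(2) by simp
    next
      case 2
      then have "T \<in> tree_sets (insert w V) (insert {w, u} E)"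
        using T by (auto simp: tree_sets_def)
      then show ?thesis using tree_sets_pendant[OF w u E] by blast
    next
      case 3
      then have "T \<in> tree_sets (insert w V) (insert {w, v} E)"
        using T by (auto simp: tree_sets_def)
      then show ?thesis using tree_sets_pendant[OF w v E] by blast
    next
      case 4
      then have TS: "insert {w, u} (insert {w, v} ?S) = T" by blast
      have S: "{u, v} \<notin> ?S" "tree (V, insert {u, v} ?S)"
        using iffD1[OF tree_subdivide_iff[OF w u v uv SV, unfolded TS] T(2)] by simp_all
      have "insert {u, v} ?S \<in> trees_through V E {u, v}"
        using S(2) SE by (auto simp: trees_through_def tree_sets_def)
      moreover have "T = insert {w, u} (insert {w, v} (insert {u, v} ?S - {{u, v}}))"
        unfolding Diff_insert_absorb[OF S(1)] TS ..
      ultimately show ?thesis by blast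
    qed
  qed
  have AB: "?A \<subseteq> ?L" "?B \<subseteq> ?L"
    unfolding tree_sets_pendant[OF w u E, symmetric] tree_sets_pendant[OF w v E, symmetric]
    by (auto simp: tree_sets_def)
  have C: "?C \<subseteq> ?L"
  proof clarify
    fix T assume "T \<in> trees_through V E {u, v}"
    then have T: "T \<subseteq> insert {u, v} E" "{u, v} \<in> T" "tree (V, T)"
      by (auto simp: trees_through_def tree_sets_def)
    let ?S = "T - {{u, v}}"
    have SE: "?S \<subseteq> E" using T(1) by blast
    then have SV: "\<Union>?S \<subseteq> V" using E by blast
    have "tree (V, insert {u, v} ?S)" using T(2,3) by (simp add: insert_absorb)
    then have "tree (insert w V, insert {w, u} (insert {w, v} ?S))"
      using tree_subdivide_iff[OF w u v uv SV] by blast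
    then show "insert {w, u} (insert {w, v} ?S) \<in> ?L"
      using SE unfolding tree_sets_def by blast
  qed
  show ?thesis by (intro equalityI Un_least AB C subsetI) (rule L)
qed

lemma card_tree_sets_parallel_edge:
  assumes "finite E" "e \<notin> E"
  shows "card (tree_sets V (insert e E)) = card (tree_sets V E) + card (trees_through V E e)"
proof -
  have "tree_sets V (insert e E) = tree_sets V E \<union> trees_through V E e"
    by (auto simp: tree_sets_def trees_through_def)
  moreover have "tree_sets V E \<inter> trees_through V E e = {}"
    using assms(2) by (auto simp: tree_sets_def trees_through_def)
  ultimately show ?thesis
    using assms(1) by (simp add: card_Un_disjoint finite_tree_sets finite_trees_through)
qed

lemma card_tree_sets_series_edge:
  assumes "w \<notin> V" "u \<in> V" "\<Union>E \<subseteq> V"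
  shows "card (tree_sets (insert w V) (insert {w, u} E)) = card (tree_sets V E)"
  unfolding tree_sets_pendant[OF assms]
proof (rule card_image_insert)
  have "{w, u} \<notin> E" using assms by blast
  then show "{w, u} \<notin> T" if "T \<in> tree_sets V E" for T
    using that by (auto simp: tree_sets_def)
qed

lemma inj_on_subdivide:
  assumes "\<And>T. T \<in> X \<Longrightarrow> e \<in> T \<and> a \<notin> T \<and> b \<notin> T"
  shows "inj_on (\<lambda>T. insert a (insert b (T - {e}))) X"
proof (rule inj_on_inverseI)
  fix T assume "T \<in> X"
  then show "insert e (insert a (insert b (T - {e})) - {a, b}) = T"
    using assms[of T] by blast
qed

text \<open>Bookkeeping for \<open>tree_sets_insert_vertex2\<close>, with \<open>a\<close> and
  \<open>b\<close> as the new edges at \<open>w\<close>: containing only \<open>a\<close>, only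
  \<open>b\<close> or both tells the families apart. Members of \<open>C\<close> have lost
  \<open>e\<close>, whence the last identity.\<close>

lemma subdivide_families:
  fixes a b e :: 'b and X Y :: "'b set set"
  defines "A \<equiv> insert a ` X" and "B \<equiv> insert b ` X"
    and "C \<equiv> (\<lambda>T. insert a (insert b (T - {e}))) ` Y"
  assumes ab: "a \<noteq> b" and X: "\<And>T. T \<in> X \<Longrightarrow> a \<notin> T \<and> b \<notin> T"
  shows "A \<inter> B = {}" "(A \<union> B) \<inter> C = {}" "B \<inter> C = {}"
    "{T \<in> A \<union> B \<union> C. b \<in> T} = B \<union> C"
    "a \<noteq> e \<Longrightarrow> b \<noteq> e \<Longrightarrow>
      {T \<in> A \<union> B \<union> C. e \<in> T} = insert a ` {T \<in> X. e \<in> T} \<union> insert b ` {T \<in> X. e \<in> T}"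
proof -
  have A: "a \<in> T \<and> b \<notin> T" if "T \<in> A" for T using that ab X by (auto simp: A_def)
  have B: "a \<notin> T \<and> b \<in> T" if "T \<in> B" for T using that ab X by (auto simp: B_def)
  have C: "a \<in> T \<and> b \<in> T" if "T \<in> C" for T using that by (auto simp: C_def)
  show "A \<inter> B = {}" using A B by auto
  show "B \<inter> C = {}" using B C by auto
  show "(A \<union> B) \<inter> C = {}" using A B C by auto
  show "{T \<in> A \<union> B \<union> C. b \<in> T} = B \<union> C" using A B C by auto
  show "{T \<in> A \<union> B \<union> C. e \<in> T} = insert a ` {T \<in> X. e \<in> T} \<union> insert b ` {T \<in> X. e \<in> T}"
    if "a \<noteq> e" "b \<noteq> e"
    using that by (auto simp: A_def B_def C_def)
qed

context
  fixes V :: "'a set" and E :: "'a set set" and w u v :: 'a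
  assumes w: "w \<notin> V" and u: "u \<in> V" and v: "v \<in> V" and uv: "u \<noteq> v"
    and E: "\<Union>E \<subseteq> V" and fin: "finite E"
begin

private lemma new_edges:
  "T \<in> tree_sets V E \<Longrightarrow> {w, u} \<notin> T \<and> {w, v} \<notin> T"
  "T \<in> trees_through V E {u, v} \<Longrightarrow> {u, v} \<in> T \<and> {w, u} \<notin> T \<and> {w, v} \<notin> T"
  "{w, u} \<noteq> {w, v}" "{w, u} \<noteq> {u, v}" "{w, v} \<noteq> {u, v}"
proof -
  have nE: "{w, u} \<notin> insert {u, v} E" "{w, v} \<notin> insert {u, v} E"
    using w u v E by (simp_all add: doubleton_eq_iff) blast+
  show "T \<in> tree_sets V E \<Longrightarrow> {w, u} \<notin> T \<and> {w, v} \<notin> T"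
    using nE by (auto simp: tree_sets_def)
  show "T \<in> trees_through V E {u, v} \<Longrightarrow> {u, v} \<in> T \<and> {w, u} \<notin> T \<and> {w, v} \<notin> T"
    using nE by (auto simp only: tree_sets_def trees_through_def mem_Collect_eq dest: subsetD)
  show "{w, u} \<noteq> {w, v}" "{w, u} \<noteq> {u, v}" "{w, v} \<noteq> {u, v}"
    using w u v uv by (auto simp: doubleton_eq_iff)
qed

text \<open>The terminal moves from \<open>u\<close> to \<open>w\<close>. A tree through
  \<open>{w, v}\<close> either omits \<open>{w, u}\<close> and has \<open>w\<close> as a leaf, or
  uses both edges and subdivides \<open>{u, v}\<close>.\<close>

lemma card_trees_through_series_edge:
  "card (trees_through (insert w V) (insert {w, u} E) {w, v}) =
    card (tree_sets V E) + card (trees_through V E {u, v})"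
proof -
  let ?h = "\<lambda>T. insert {w, u} (insert {w, v} (T - {{u, v}}))"
  have "trees_through (insert w V) (insert {w, u} E) {w, v} =
    {T \<in> tree_sets (insert w V) (insert {w, u} (insert {w, v} E)). {w, v} \<in> T}"
    by (simp add: trees_through_def insert_commute)
  also have "\<dots> = insert {w, v} ` tree_sets V E \<union> ?h ` trees_through V E {u, v}"
    unfolding tree_sets_insert_vertex2[OF w u v uv E]
    by (rule subdivide_families(4)) (use new_edges in simp_all)
  finally have eq: "trees_through (insert w V) (insert {w, u} E) {w, v} = \<dots>" .
  have "insert {w, v} ` tree_sets V E \<inter> ?h ` trees_through V E {u, v} = {}"
    by (rule subdivide_families(3)) (use new_edges in simp_all)
  moreover have "card (?h ` trees_through V E {u, v}) = card (trees_through V E {u, v})"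
    by (intro card_image inj_on_subdivide new_edges(2))
  moreover have "card (insert {w, v} ` tree_sets V E) = card (tree_sets V E)"
    by (rule card_image_insert) (simp add: new_edges)
  ultimately show ?thesis
    unfolding eq using fin by (simp add: card_Un_disjoint finite_tree_sets finite_trees_through)
qed

text \<open>The three families of \<open>tree_sets_insert_vertex2\<close> contribute
  \<open>t\<close>, \<open>t\<close> and \<open>f\<close>.\<close>

lemma card_tree_sets_parallel_path:
  "card (tree_sets (insert w V) (insert {w, u} (insert {w, v} E))) =
    2 * card (tree_sets V E) + card (trees_through V E {u, v})"
proof -
  let ?h = "\<lambda>T. insert {w, u} (insert {w, v} (T - {{u, v}}))"
  have "card (?h ` trees_through V E {u, v}) = card (trees_through V E {u, v})"
    by (intro card_image inj_on_subdivide new_edges(2))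
  moreover have "card (insert {w, v} ` tree_sets V E) = card (tree_sets V E)"
    "card (insert {w, u} ` tree_sets V E) = card (tree_sets V E)"
    by (rule card_image_insert; simp add: new_edges)+
  moreover have "insert {w, u} ` tree_sets V E \<inter> insert {w, v} ` tree_sets V E = {}"
    "(insert {w, u} ` tree_sets V E \<union> insert {w, v} ` tree_sets V E) \<inter>
      ?h ` trees_through V E {u, v} = {}"
    by (rule subdivide_families(1,2); use new_edges in simp)+
  ultimately show ?thesis
    unfolding tree_sets_insert_vertex2[OF w u v uv E]
    using fin by (simp add: card_Un_disjoint finite_tree_sets finite_trees_through)
qed

end

text \<open>A tree containing \<open>{u, v}\<close> uses exactly one of the two new edges, since
  both would close a triangle.\<close>

lemma card_trees_through_parallel_path:
  assumes w: "w \<notin> V" and u: "u \<in> V" and v: "v \<in> V" and uv: "u \<noteq> v"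
    and E: "\<Union>E \<subseteq> V" and fin: "finite E"
  shows "card (trees_through (insert w V) (insert {w, u} (insert {w, v} E)) {u, v}) =
    2 * card (trees_through V E {u, v})"
proof -
  \<comment> \<open>\<open>{u, v}\<close> joins the edge set first;
    \<open>tree_sets_insert_vertex2\<close> is applied to the result, and the trees containing
    \<open>{u, v}\<close> are selected afterwards.\<close>
  let ?E = "insert {u, v} E" and ?t = "trees_through V E {u, v}"
  have E': "\<Union>?E \<subseteq> V" using E u v by blast
  have ne: "{w, u} \<noteq> {w, v}" "{w, u} \<noteq> {u, v}" "{w, v} \<noteq> {u, v}"
    using w u v uv by (auto simp: doubleton_eq_iff)
  have "{w, u} \<notin> ?E" "{w, v} \<notin> ?E" using w E' by blast+
  then have nX: "{w, u} \<notin> T \<and> {w, v} \<notin> T" if "T \<in> tree_sets V ?E" for T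
    using that unfolding tree_sets_def by blast
  have nt: "{w, u} \<notin> T \<and> {w, v} \<notin> T" if "T \<in> ?t" for T
    using that nX unfolding trees_through_def by simp
  have "trees_through (insert w V) (insert {w, u} (insert {w, v} E)) {u, v} =
    {T \<in> tree_sets (insert w V) (insert {w, u} (insert {w, v} ?E)). {u, v} \<in> T}"
    by (simp add: trees_through_def insert_commute)
  also have "\<dots> = insert {w, u} ` ?t \<union> insert {w, v} ` ?t"
    unfolding tree_sets_insert_vertex2[OF w u v uv E'] trees_through_def[of V E]
    by (rule subdivide_families(5)) (use ne nX in simp_all)
  finally have eq: "trees_through (insert w V) (insert {w, u} (insert {w, v} E)) {u, v} = \<dots>" .
  have "card (insert {w, v} ` ?t) = card ?t" "card (insert {w, u} ` ?t) = card ?t"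
    by (rule card_image_insert; simp add: nt)+
  moreover have "insert {w, u} ` ?t \<inter> insert {w, v} ` ?t = {}"
    by (rule subdivide_families(1)) (use nt ne in simp_all)
  ultimately show ?thesis
    unfolding eq using fin by (simp add: card_Un_disjoint finite_trees_through)
qed

section \<open>A straight-line drawing\<close>

text \<open>
  Vertex \<open>0\<close> is the hub at the origin. The vertices \<open>k\<close> with \<open>k mod 3 = 1\<close> form the spine on the line
  \<open>x = 1\<close>, and \<open>k + 1\<close>, \<open>k + 2\<close> are leaves hanging from \<open>k\<close>, on the line \<open>x = 1/2\<close>. The slope of the
  ray from the hub to vertex \<open>k\<close> is \<open>k\<close>.
\<close>

definition radius :: "nat \<Rightarrow> real" where
  "radius k = (if k = 0 then 0 else if k mod 3 = 1 then 1 else 1/2)"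

definition pos :: "nat \<Rightarrow> real \<times> real" where
  "pos k = (radius k, radius k * real k)"

text \<open>One infinite host graph contains every network as a finite subgraph, so the drawing is
  checked only once. The smaller end comes first.\<close>

definition host_edge :: "nat \<Rightarrow> nat \<Rightarrow> bool" where
  "host_edge a b \<longleftrightarrow> a = 0 \<and> b \<ge> 1 \<or> a mod 3 = 1 \<and> b \<in> {a + 1, a + 2, a + 3}"

lemma inj_pos: "inj pos"
  by (rule injI) (auto simp: pos_def radius_def split: if_splits)

lemma mem_segment_iff:
  fixes a b :: "real \<times> real"
  shows "z \<in> closed_segment a b \<longleftrightarrow>
    (\<exists>s\<in>{0..1}. z = ((1 - s) * fst a + s * fst b, (1 - s) * snd a + s * snd b))"
  by (cases z; cases a; cases b) (auto simp: in_segment)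

lemma radial_segment:
  assumes "k \<ge> 1" "(x, y) \<in> closed_segment (pos 0) (pos k)"
  shows "0 \<le> x \<and> x \<le> radius k \<and> y = x * real k"
  using assms by (auto simp: mem_segment_iff pos_def radius_def mult_le_one)

lemma spine_segment:
  assumes "k mod 3 = 1" "(x, y) \<in> closed_segment (pos k) (pos (k + 3))"
  shows "x = 1 \<and> real k \<le> y \<and> y \<le> real k + 3"
proof -
  have "radius k = 1" "radius (k + 3) = 1" using assms by (auto simp: radius_def)
  then show ?thesis using assms(2) by (auto simp: mem_segment_iff pos_def algebra_simps)
qed

text \<open>The segment lies on the line through \<open>(0, j)\<close> and
  \<open>(1, k)\<close>.\<close>

lemma leaf_segment:
  assumes "k mod 3 = 1" "j \<in> {1, 2}" "(x, y) \<in> closed_segment (pos k) (pos (k + j))"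
  shows "1/2 \<le> x \<and> x \<le> 1 \<and> y = x * real k + (1 - x) * real j"
proof -
  have k: "radius k = 1" "radius (k + j) = 1/2"
    using assms by (auto simp: radius_def) presburger+
  from assms(3) obtain s where s: "0 \<le> s" "s \<le> 1" "x = 1 - s + s / 2"
     "y = (1 - s) * real k + s / 2 * (real k + real j)"
    by (auto simp: mem_segment_iff pos_def k)
  have s': "s = 2 - 2 * x" using s(3) by simp
  show ?thesis using s(1,2,4) unfolding s' by (auto simp: field_simps)
qed

lemma host_edge_cases [consumes 1, case_names radial spine leaf]:
  assumes "host_edge a b"
  obtains "a = 0" "b \<ge> 1"
  | "a mod 3 = 1" "b = a + 3"
  | j where "a mod 3 = 1" "j \<in> {1, 2}" "b = a + j"
  using assms unfolding host_edge_def by auto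

text \<open>A vertex has radius 0, 1/2 or 1. On a leaf segment radius 1 forces \<open>c = a\<close>
  and radius 1/2 forces \<open>c = a + j\<close>; on a spine segment the residue modulo 3 leaves
  only the two ends.\<close>

lemma vertex_on_host_segment:
  assumes "host_edge a b" "pos c \<in> closed_segment (pos a) (pos b)"
  shows "c = a \<or> c = b"
  using assms(1)
proof (cases rule: host_edge_cases)
  case radial
  then have "radius c * real c = radius c * real b"
    using radial_segment[of b "radius c" "radius c * real c"] assms(2) by (simp add: pos_def)
  then show ?thesis using radial by (auto simp: radius_def split: if_splits)
next
  case spine
  then have c: "radius c = 1" "real a \<le> radius c * real c" "radius c * real c \<le> real a + 3"
    using spine_segment[of a "radius c" "radius c * real c"] assms(2) by (auto simp: pos_def)
  then have "c mod 3 = 1" "a \<le> c" "c \<le> a + 3" by (auto simp: radius_def split: if_splits)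
  then show ?thesis using spine by presburger
next
  case (leaf j)
  then have "1/2 \<le> radius c"
    "radius c * real c = radius c * real a + (1 - radius c) * real j"
    using leaf_segment[of a j "radius c" "radius c * real c"] assms(2) by (auto simp: pos_def)
  then show ?thesis using leaf by (auto simp: radius_def split: if_splits)
qed

lemma pos_spine: "k mod 3 = 1 \<Longrightarrow> pos k = (1, real k)"
  by (auto simp: pos_def radius_def)

lemma host_segments_meet_at_vertex:
  assumes "host_edge a b" "host_edge c d" "(a, b) \<noteq> (c, d)"
    and z: "z \<in> closed_segment (pos a) (pos b)" "z \<in> closed_segment (pos c) (pos d)"
  shows "z \<in> range pos"
proof -
  obtain x y where xy: "z = (x, y)" by fastforce
  \<comment> \<open>The letters in the names of the next five facts stand for radial, spine and leaf
    edges.\<close>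
  have rs: "(x, y) \<in> range pos"
    if "1 \<le> b" "c mod 3 = 1" "(x, y) \<in> closed_segment (pos 0) (pos b)"
      "(x, y) \<in> closed_segment (pos c) (pos (c + 3))" for b c
  proof -
    have "x = 1" "x \<le> radius b" "y = x * real b"
      using radial_segment[OF that(1,3)] spine_segment[OF that(2,4)] by auto
    then have "(x, y) = pos b" by (auto simp: pos_def radius_def split: if_splits)
    then show ?thesis by blast
  qed
  have rl: "(x, y) \<in> range pos"
    if "1 \<le> b" "c mod 3 = 1" "j \<in> {1, 2}" "(x, y) \<in> closed_segment (pos 0) (pos b)"
      "(x, y) \<in> closed_segment (pos c) (pos (c + j))" for b c j
  proof -
    have x: "1/2 \<le> x" "x \<le> 1" "x \<le> radius b" "y = x * real b"
      and y: "y = x * real c + (1 - x) * real j"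
      using radial_segment[OF that(1,4)] leaf_segment[OF that(2,3,5)] by auto
    show ?thesis
    proof (cases "b mod 3 = 1")
      \<comment> \<open>The ray to a leaf stops at \<open>x = 1/2\<close>, and leaf edges stay in
        \<open>x \<ge> 1/2\<close>, so they can touch only at \<open>b\<close>.\<close>
      case False
      then have "(x, y) = pos b" using x that(1) by (auto simp: pos_def radius_def)
      then show ?thesis by blast
    next
      case True
      \<comment> \<open>Seen from the hub, points of the leaf edge have slopes in
        \<open>[c, c + 2]\<close>, and \<open>c\<close> is the only spine vertex in this
        range.\<close>
      have eq: "x * (real b - real c) = (1 - x) * real j" using x y by (simp add: algebra_simps)
      have "(1 - x) * real j \<le> x * 2" "0 \<le> (1 - x) * real j"
        using x that(3) by auto
      then have "x * (real b - real c) \<le> x * 2" "x * 0 \<le> x * (real b - real c)"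
        using eq by simp_all
      then have "real b - real c \<le> 2" "0 \<le> real b - real c"
        using x(1) by (simp_all only: mult_le_cancel_left_pos)
      then have "b \<le> c + 2" "c \<le> b" by simp_all
      then have "b = c" using True that(2) by presburger
      then have "x = 1" using eq that(3) by auto
      then have "(x, y) = pos b" using x True by (simp add: pos_spine)
      then show ?thesis by blast
    qed
  qed
  have sl: "(x, y) \<in> range pos"
    if "a mod 3 = 1" "c mod 3 = 1" "j \<in> {1, 2}" "(x, y) \<in> closed_segment (pos a) (pos (a + 3))"
      "(x, y) \<in> closed_segment (pos c) (pos (c + j))" for a c j
  proof -
    have "(x, y) = pos c"
      using spine_segment[OF that(1,4)] leaf_segment[OF that(2,3,5)] pos_spine[OF that(2)] by auto
    then show ?thesis by blast
  qed
  have ss: "(x, y) \<in> range pos"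
    if "a mod 3 = 1" "c mod 3 = 1" "a < c" "(x, y) \<in> closed_segment (pos a) (pos (a + 3))"
      "(x, y) \<in> closed_segment (pos c) (pos (c + 3))" for a c
  proof -
    have "c \<ge> a + 3" using that(1-3) by presburger
    then have "(x, y) = pos c"
      using spine_segment[OF that(1,4)] spine_segment[OF that(2,5)] pos_spine[OF that(2)] by auto
    then show ?thesis by blast
  qed
  have ll: False
    if "a mod 3 = 1" "c mod 3 = 1" "a < c" "i \<in> {1, 2}" "j \<in> {1, 2}"
      "(x, y) \<in> closed_segment (pos a) (pos (a + i))"
      "(x, y) \<in> closed_segment (pos c) (pos (c + j))" for a c i j
  proof -
    have x: "1/2 \<le> x" "x \<le> 1" and eq: "x * real a + (1 - x) * real i = x * real c + (1 - x) * real j"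
      using leaf_segment[OF that(1,4,6)] leaf_segment[OF that(2,5,7)] by auto
    \<comment> \<open>A common point would give \<open>3 * x \<le> 1 - x\<close>, contrary to
      \<open>x \<ge> 1/2\<close>.\<close>
    have "c \<ge> a + 3" using that(1-3) by presburger
    then have "x * (real a + 3) \<le> x * real c" using x by (intro mult_left_mono) auto
    moreover have "(1 - x) * (real i - real j) \<le> (1 - x) * 1"
      using x that(4,5) by (intro mult_left_mono) auto
    ultimately show False using eq x by (simp add: algebra_simps)
  qed
  have "(x, y) \<in> range pos"
    using assms(1)
  proof (cases rule: host_edge_cases)
    case r: radial
    show ?thesis using assms(2)
    proof (cases rule: host_edge_cases)
      case radial
      then have "x * real b = x * real d" "b \<noteq> d" "y = x * real b"
        using radial_segment[of b x y] radial_segment[of d x y] r z xy assms(3) by auto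
      then have "(x, y) = pos 0" by (simp add: pos_def radius_def)
      then show ?thesis by blast
    next
      case spine
      then show ?thesis using rs[of b c] r z xy by simp
    next
      case (leaf j)
      then show ?thesis using rl[of b c j] r z xy by simp
    qed
  next
    case s: spine
    show ?thesis using assms(2)
    proof (cases rule: host_edge_cases)
      case radial
      then show ?thesis using rs[of d a] s z xy by simp
    next
      case spine
      then have "a < c \<or> c < a" using s assms(3) by auto
      then show ?thesis using ss[of a c] ss[of c a] spine s z xy by auto
    next
      case (leaf j)
      then show ?thesis using sl[of a c j] s z xy by simp
    qed
  next
    case l: (leaf i)
    show ?thesis using assms(2)
    proof (cases rule: host_edge_cases)
      case radial
      then show ?thesis using rl[of d a i] l z xy by simp
    next
      case spine
      then show ?thesis using sl[of c a i] l z xy by simp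
    next
      case (leaf j)
      then have "a = c" using ll[of a c i j] ll[of c a j i] l z xy by (cases a c rule: linorder_cases) auto
      then have "i \<noteq> j" "(1 - x) * real i = (1 - x) * real j" "y = x * real a + (1 - x) * real i"
        using leaf_segment[of a i x y] leaf_segment[of c j x y] leaf l z xy assms(3) by auto
      then have "(x, y) = pos a" using pos_spine[of a] l by auto
      then show ?thesis by blast
    qed
  qed
  then show ?thesis using xy by simp
qed

lemma planar_host_subgraph:
  assumes "\<And>e. e \<in> E \<Longrightarrow> e \<subseteq> V \<and> (\<exists>a b. e = {a, b} \<and> host_edge a b)"
  shows "planar (V, E)"
proof -
  \<comment> \<open>Edges are unordered; \<open>Min\<close> and \<open>Max\<close> recover the
    ordered ends of a host edge.\<close>
  define \<gamma> where "\<gamma> e = linepath (pos (Min e)) (pos (Max e))" for e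
  have \<gamma>: "\<gamma> {a, b} = linepath (pos a) (pos b)" "a < b" if "host_edge a b" for a b
    using that by (auto simp: \<gamma>_def host_edge_def min_def max_def)
  have "plane_drawing (V, E) pos \<gamma>"
    unfolding plane_drawing_def fst_conv snd_conv
  proof (intro conjI ballI impI)
    show "inj_on pos V" using inj_pos by (rule inj_on_subset) simp
  next
    fix e assume e: "e \<in> E"
    obtain a b where ab: "e = {a, b}" "host_edge a b" using assms[OF e] by blast
    have "pos a \<noteq> pos b" using \<gamma>(2)[OF ab(2)] inj_pos by (auto simp: inj_def)
    then show "arc (\<gamma> e)" "{pathstart (\<gamma> e), pathfinish (\<gamma> e)} = pos ` e"
      using \<gamma>[OF ab(2)] ab(1) by (simp_all add: arc_linepath)
    have "a \<in> V" "b \<in> V" using assms[OF e] ab(1) by auto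
    then show "path_image (\<gamma> e) \<inter> pos ` V = pos ` e"
      unfolding ab(1) \<gamma>(1)[OF ab(2)] path_image_linepath
      by (auto dest!: vertex_on_host_segment[OF ab(2)])
  next
    fix e f assume e: "e \<in> E" and f: "f \<in> E" and "e \<noteq> f"
    obtain a b where ab: "e = {a, b}" "host_edge a b" using assms[OF e] by blast
    obtain c d where cd: "f = {c, d}" "host_edge c d" using assms[OF f] by blast
    have "(a, b) \<noteq> (c, d)" using \<open>e \<noteq> f\<close> ab cd by auto
    note meet = host_segments_meet_at_vertex[OF ab(2) cd(2) this]
    have "z \<in> pos ` (e \<inter> f)"
      if z: "z \<in> closed_segment (pos a) (pos b)" "z \<in> closed_segment (pos c) (pos d)" for z
    proof -
      obtain k where k: "z = pos k" using meet[OF z] by blast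
      then show ?thesis
        using vertex_on_host_segment[OF ab(2), of k] vertex_on_host_segment[OF cd(2), of k] z ab cd
        by auto
    qed
    moreover have "pos ` (e \<inter> f) \<subseteq> closed_segment (pos a) (pos b) \<inter> closed_segment (pos c) (pos d)"
      using ab cd by auto
    ultimately show "path_image (\<gamma> e) \<inter> path_image (\<gamma> f) = pos ` (e \<inter> f)"
      using \<gamma>(1)[OF ab(2)] \<gamma>(1)[OF cd(2)] ab(1) cd(1) by (simp only: path_image_linepath) blast
  qed
  then show ?thesis unfolding planar_def by blast
qed

section \<open>Networks\<close>

text \<open>
  A two-terminal network with terminals the hub \<open>0\<close> and the current end \<open>u\<close> of the spine. Its
  conductance is \<open>t / f\<close>.
\<close>

definition net :: "nat set \<Rightarrow> nat set set \<Rightarrow> nat \<Rightarrow> nat \<Rightarrow> nat \<Rightarrow> bool" where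
  "net V E u t f \<longleftrightarrow> V \<subseteq> {..u + 2} \<and> 0 \<in> V \<and> u \<in> V \<and> u mod 3 = 1 \<and>
     (\<forall>e\<in>E. e \<subseteq> V \<and> (\<exists>a b. e = {a, b} \<and> host_edge a b)) \<and>
     card (tree_sets V E) = t \<and> card (trees_through V E {u, 0}) = f"

lemma netD:
  assumes "net V E u t f"
  shows "finite V" "finite E" "\<Union>E \<subseteq> V" "u \<noteq> 0" "u \<in> V" "0 \<in> V"
proof -
  show V: "finite V" using assms finite_subset unfolding net_def by blast
  show "\<Union>E \<subseteq> V" using assms unfolding net_def by blast
  then have "E \<subseteq> Pow V" by blast
  then show "finite E" using V finite_subset by blast
  show "u \<noteq> 0" "u \<in> V" "0 \<in> V" using assms by (auto simp: net_def)
qed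

lemma host_edge_doubleton:
  "u mod 3 = 1 \<Longrightarrow> w \<in> {u + 1, u + 2, u + 3} \<Longrightarrow> \<exists>a b. {w, u} = {a, b} \<and> host_edge a b"
  "w \<noteq> 0 \<Longrightarrow> \<exists>a b. {w, 0} = {a, b} \<and> host_edge a b"
proof -
  show "\<exists>a b. {w, u} = {a, b} \<and> host_edge a b" if "u mod 3 = 1" "w \<in> {u + 1, u + 2, u + 3}"
    by (rule exI[of _ u], rule exI[of _ w]) (use that in \<open>auto simp: host_edge_def\<close>)
  show "\<exists>a b. {w, 0} = {a, b} \<and> host_edge a b" if "w \<noteq> 0"
    by (rule exI[of _ 0], rule exI[of _ w]) (use that in \<open>auto simp: host_edge_def\<close>)
qed

lemma net_edge:
  assumes "net V E u t f" "{u, 0} \<notin> E"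
  shows "net V (insert {u, 0} E) u (t + f) f"
  using assms card_tree_sets_parallel_edge[of E "{u, 0}" V] netD[OF assms(1)] host_edge_doubleton(2)[of u]
  by (simp add: net_def trees_through_def)

lemma net_leaf:
  assumes "net V E u t f" "w \<in> {u + 1, u + 2}" "w \<notin> V"
  shows "net (insert w V) (insert {w, u} (insert {w, 0} E)) u (2 * t + f) (2 * f)"
proof -
  note D = netD[OF assms(1)]
  note card_tree_sets_parallel_path[OF assms(3) D(5,6,4,3,2)]
    card_trees_through_parallel_path[OF assms(3) D(5,6,4,3,2)]
  then show ?thesis
    using assms host_edge_doubleton(1)[of u w] host_edge_doubleton(2)[of w]
    unfolding net_def by auto
qed

lemma net_series:
  assumes "net V E u t f"
  shows "net (insert (u + 3) V) (insert {u + 3, u} E) (u + 3) t (t + f)"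
proof -
  note D = netD[OF assms]
  \<comment> \<open>The bound \<open>V \<subseteq> {..u + 2}\<close> in \<open>net\<close> keeps the
    next spine vertex free.\<close>
  have w: "u + 3 \<notin> V" using assms by (auto simp: net_def)
  note card_tree_sets_series_edge[OF w D(5,3)] card_trees_through_series_edge[OF w D(5,6,4,3,2)]
  then show ?thesis
    using assms host_edge_doubleton(1)[of u "u + 3"] unfolding net_def by auto
qed

text \<open>
  An open network, one whose terminals are not adjacent, can still receive the edge \<open>{u, 0}\<close> without
  becoming a multigraph.
\<close>

definition open_net :: "nat \<Rightarrow> nat \<Rightarrow> nat \<Rightarrow> bool" where
  "open_net n t f \<longleftrightarrow> (\<exists>V E u. net V E u t f \<and> card V = n \<and> {u, 0} \<notin> E \<and> V \<subseteq> {..u})"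

lemma open_net_series:
  assumes "net V E u t f"
  shows "open_net (Suc (card V)) t (t + f)"
proof -
  note D = netD[OF assms]
  have w: "u + 3 \<notin> V" "V \<subseteq> {..u + 3}" using assms by (auto simp: net_def)
  then have "{u + 3, 0} \<notin> insert {u + 3, u} E" using D(3,4) by (auto simp: doubleton_eq_iff)
  then show ?thesis
    unfolding open_net_def
    using net_series[OF assms] w D(1)
    by (intro exI[of _ "insert (u + 3) V"] exI[of _ "insert {u + 3, u} E"] exI[of _ "u + 3"]) simp
qed

lemma open_net_cong: "open_net n t f \<Longrightarrow> n = n' \<Longrightarrow> t = t' \<Longrightarrow> f = f' \<Longrightarrow> open_net n' t' f'"
  by simp

text \<open>Each move ends with a series edge, whose new terminal is not adjacent to the hub and
  carries no leaves yet, so moves can be repeated.\<close>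

lemma open_net_steps:
  assumes "open_net n t f"
  shows "open_net (n + 1) t (t + f)"
    and "open_net (n + 1) (t + f) (t + 2 * f)"
    and "open_net (n + 2) (2 * t + 3 * f) (2 * t + 5 * f)"
    and "open_net (n + 3) (4 * t + 8 * f) (4 * t + 12 * f)"
proof -
  obtain V E u where net: "net V E u t f" and V: "card V = n" "V \<subseteq> {..u}" and E: "{u, 0} \<notin> E"
    using assms by (auto simp: open_net_def)
  have nV: "u + 1 \<notin> V" "u + 2 \<notin> insert (u + 1) V" using V(2) by auto
  let ?V1 = "insert (u + 1) V" and ?E1 = "insert {u + 1, u} (insert {u + 1, 0} E)"
  let ?V2 = "insert (u + 2) ?V1" and ?E2 = "insert {u + 2, u} (insert {u + 2, 0} ?E1)"
  have n1: "net ?V1 ?E1 u (2 * t + f) (2 * f)"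
    by (rule net_leaf[OF net]) (use nV in auto)
  have n2: "net ?V2 ?E2 u (2 * (2 * t + f) + 2 * f) (2 * (2 * f))"
    by (rule net_leaf[OF n1]) (use nV in auto)
  have E1: "{u, 0} \<notin> ?E1" and E2: "{u, 0} \<notin> ?E2"
    using E by (auto simp: doubleton_eq_iff)
  have c1: "card ?V1 = n + 1" using netD(1)[OF net] nV(1) V(1) by simp
  have c2: "card ?V2 = n + 2" using netD(1)[OF n1] nV(2) c1 by simp
  note c = V(1) c1 c2
  show "open_net (n + 1) t (t + f)"
    by (rule open_net_cong[OF open_net_series[OF net]]) (unfold c, simp_all)
  show "open_net (n + 1) (t + f) (t + 2 * f)"
    by (rule open_net_cong[OF open_net_series[OF net_edge[OF net E]]]) (unfold c, simp_all)
  show "open_net (n + 2) (2 * t + 3 * f) (2 * t + 5 * f)"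
    by (rule open_net_cong[OF open_net_series[OF net_edge[OF n1 E1]]]) (unfold c, simp_all)
  show "open_net (n + 3) (4 * t + 8 * f) (4 * t + 12 * f)"
    by (rule open_net_cong[OF open_net_series[OF net_edge[OF n2 E2]]]) (unfold c, simp_all)
qed

text \<open>Grown from two isolated terminals, where \<open>(t, f) = (0, 1)\<close>: joining them
  and extending the spine gives the path on three vertices.\<close>

lemma open_net_base: "open_net 3 1 2"
proof -
  have "tree ({0::nat}, {})" by (simp add: tree_iff simple_graph_def)
  then have "tree ({1, 0::nat}, {{1, 0}})"
    using tree_pendant_iff[of 1 "{0::nat}" 0 "{}"] by simp
  then have "trees_through {1, 0::nat} {} {1, 0} = {{{1, 0}}}"
    unfolding trees_through_def tree_sets_def by auto
  moreover have "tree_sets {1, 0::nat} {} = {}"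
    using not_tree_isolated[of 1 "{0::nat}" 0 "{}"] by (auto simp: tree_sets_def)
  ultimately have "net {1, 0} {} 1 0 1" by (simp add: net_def)
  then have "open_net 2 0 1" unfolding open_net_def
    by (intro exI[of _ "{1, 0}"] exI[of _ "{}"] exI[of _ 1]) simp
  from open_net_steps(2)[OF this] show ?thesis by (rule open_net_cong) simp_all
qed

lemma open_net_series_iterate: "open_net n t f \<Longrightarrow> open_net (n + k) t (f + k * t)"
proof (induction k)
  case (Suc k)
  from open_net_steps(1)[OF Suc.IH[OF Suc.prems]] show ?case by (simp add: algebra_simps)
qed simp

section \<open>Networks as simple planar graphs\<close>

lemma simple_graph_host_subgraph:
  assumes "finite V" "\<And>e. e \<in> E \<Longrightarrow> e \<subseteq> V \<and> (\<exists>a b. e = {a, b} \<and> host_edge a b)"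
  shows "simple_graph (V, E)"
proof -
  have "card {a, b} = 2" if "host_edge a b" for a b
    using that by (auto simp: host_edge_def)
  then show ?thesis using assms unfolding simple_graph_def by fastforce
qed

lemma net_in_spectrum:
  assumes "net V E u t f"
  shows "t \<in> tree_spectrum (graphs_pla (card V))"
proof -
  have E: "e \<subseteq> V \<and> (\<exists>a b. e = {a, b} \<and> host_edge a b)" if "e \<in> E" for e
    using assms that unfolding net_def by blast
  then have "(V, E) \<in> graphs_pla (card V)"
    using simple_graph_host_subgraph[OF netD(1)[OF assms]] planar_host_subgraph[of E V]
    by (simp add: graphs_pla_def graphs_all_def)
  moreover have "\<tau> (V, E) = t"
    using assms by (simp add: num_spanning_trees_eq_card_tree_sets net_def)
  ultimately show ?thesis unfolding tree_spectrum_def by blast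
qed

lemma open_net_in_spectrum:
  assumes "open_net n t f"
  shows "t \<in> tree_spectrum (graphs_pla n)" "t + f \<in> tree_spectrum (graphs_pla n)"
  using assms net_in_spectrum net_edge unfolding open_net_def by blast+

section \<open>Counting pairs\<close>

text \<open>
  On pairs \<open>(t, f)\<close>: extend the spine \<open>k\<close> times, add conductance \<open>1\<close> (an edge), \<open>3/2\<close> (an edge and a
  path of length two) or \<open>2\<close> (an edge and two such paths) between the terminals, and extend the spine once
  more. For \<open>chi\<close>, \<open>k = 0\<close>.
\<close>

definition phi :: "nat \<Rightarrow> nat \<times> nat \<Rightarrow> nat \<times> nat" where
  "phi k = (\<lambda>(t, f). ((k + 1) * t + f, (2 * k + 1) * t + 2 * f))"

definition psi :: "nat \<Rightarrow> nat \<times> nat \<Rightarrow> nat \<times> nat" where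
  "psi k = (\<lambda>(t, f). ((3 * k + 2) * t + 3 * f, (5 * k + 2) * t + 5 * f))"

definition chi :: "nat \<times> nat \<Rightarrow> nat \<times> nat" where
  "chi = (\<lambda>(t, f). (4 * t + 8 * f, 4 * t + 12 * f))"

lemma open_net_moves:
  assumes "open_net n (fst p) (snd p)"
  shows "open_net (n + k + 1) (fst (phi k p)) (snd (phi k p))"
    and "open_net (n + k + 2) (fst (psi k p)) (snd (psi k p))"
    and "open_net (n + 3) (fst (chi p)) (snd (chi p))"
proof -
  obtain t f where p: "p = (t, f)" by fastforce
  then have "open_net (n + k) t (f + k * t)" "open_net n t f"
    using assms open_net_series_iterate by auto
  note steps = open_net_steps(2,3)[OF this(1)] open_net_steps(4)[OF this(2)]
  show "open_net (n + k + 1) (fst (phi k p)) (snd (phi k p))"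
    using steps(1) by (simp add: p phi_def algebra_simps)
  show "open_net (n + k + 2) (fst (psi k p)) (snd (psi k p))"
    using steps(2) by (simp add: p psi_def algebra_simps)
  show "open_net (n + 3) (fst (chi p)) (snd (chi p))"
    using steps(3) by (simp add: p chi_def)
qed

text \<open>Index \<open>n\<close> belongs to \<open>n + 3\<close> vertices. The initial singletons
  are successive images of \<open>(1, 2)\<close> under \<open>phi 0\<close>. The maps
  \<open>phi k\<close>, \<open>psi k\<close> and \<open>chi\<close> cost \<open>k + 1\<close>,
  \<open>k + 2\<close> and \<open>3\<close> vertices.\<close>

fun pairs :: "nat \<Rightarrow> (nat \<times> nat) set" where
  "pairs 0 = {(1, 2)}"
| "pairs (Suc 0) = {(3, 5)}"
| "pairs (Suc (Suc 0)) = {(8, 13)}"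
| "pairs (Suc (Suc (Suc 0))) = {(21, 34)}"
| "pairs (Suc (Suc (Suc (Suc n)))) =
     phi 0 ` pairs (n + 3) \<union>
     (phi 1 ` pairs (n + 2) \<union> psi 0 ` pairs (n + 2)) \<union>
     (phi 2 ` pairs (n + 1) \<union> psi 1 ` pairs (n + 1) \<union> chi ` pairs (n + 1)) \<union>
     (phi 3 ` pairs n \<union> psi 2 ` pairs n)"

lemma open_net_pairs: "p \<in> pairs n \<Longrightarrow> open_net (n + 3) (fst p) (snd p)"
proof (induction n arbitrary: p rule: pairs.induct)
  case 1
  then show ?case using open_net_base by simp
next
  case 2
  have "open_net 4 3 5" by (rule open_net_cong[OF open_net_steps(2)[OF open_net_base]]) simp_all
  then show ?case using 2 by simp
next
  case 3
  have "open_net 5 8 13"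
    by (rule open_net_cong[OF open_net_steps(2)[OF open_net_steps(2)[OF open_net_base]]]) simp_all
  then show ?case using 3 by simp
next
  case 4
  have "open_net 6 21 34"
    by (rule open_net_cong[OF
      open_net_steps(2)[OF open_net_steps(2)[OF open_net_steps(2)[OF open_net_base]]]]) simp_all
  then show ?case using 4 by simp
next
  case (5 n)
  have 0: "open_net (n + 3) (fst p) (snd p)" if "p \<in> pairs n" for p
    using 5 that by blast
  have 1: "open_net (n + 4) (fst p) (snd p)" if "p \<in> pairs (n + 1)" for p
    using 5 that by (fastforce simp: add.commute)
  have 2: "open_net (n + 5) (fst p) (snd p)" if "p \<in> pairs (n + 2)" for p
    using 5 that by (fastforce simp: add.commute)
  have 3: "open_net (n + 6) (fst p) (snd p)" if "p \<in> pairs (n + 3)" for p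
    using 5 that by (fastforce simp: add.commute)
  have "Suc (Suc (Suc (Suc n))) + 3 = n + 7" by simp
  with "5.prems" show ?case
    using open_net_moves(1)[OF 3, of _ 0] open_net_moves(1)[OF 2, of _ 1]
      open_net_moves(2)[OF 2, of _ 0] open_net_moves(1)[OF 1, of _ 2]
      open_net_moves(2)[OF 1, of _ 1] open_net_moves(3)[OF 1]
      open_net_moves(1)[OF 0, of _ 3] open_net_moves(2)[OF 0, of _ 2]
    by (auto simp: add.commute)
qed

text \<open>
  The conductance \<open>x = t / f\<close> lies in \<open>[1/2, 3/4)\<close>. On this interval the values of \<open>1 + x / (1 + k x)\<close>
  for \<open>k \<le> 3\<close>, of \<open>3/2 + x / (1 + k x)\<close> for \<open>k \<le> 2\<close> and of \<open>2 + x\<close> fill disjoint intervals.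
\<close>

definition ratio_cone :: "(nat \<times> nat) set" where
  "ratio_cone = {(t, f). f \<le> 2 * t \<and> 4 * t < 3 * f}"

text \<open>The last series edge turns a conductance \<open>y\<close> into
  \<open>y / (1 + y)\<close>, and before it \<open>1 \<le> y < 3\<close>.\<close>

lemma moves_cone:
  "p \<in> ratio_cone \<Longrightarrow> phi k p \<in> ratio_cone" "p \<in> ratio_cone \<Longrightarrow> psi k p \<in> ratio_cone" "p \<in> ratio_cone \<Longrightarrow> chi p \<in> ratio_cone"
  by (cases p; simp add: ratio_cone_def phi_def psi_def chi_def algebra_simps)+

lemma pairs_subset_cone: "pairs n \<subseteq> ratio_cone"
proof (induction n rule: pairs.induct)
  case (5 n)
  then show ?case by (auto intro!: moves_cone)
qed (auto simp: ratio_cone_def)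

lemma finite_pairs: "finite (pairs n)"
  by (induction n rule: pairs.induct) auto

lemma inj_moves: "inj (phi k)" "inj (psi k)" "inj chi"
proof -
  show "inj (phi k)"
  proof (rule injI, clarify)
    fix t f t' f' assume "phi k (t, f) = phi k (t', f')"
    then have eq: "(k + 1) * t + f = (k + 1) * t' + f'"
      "(2 * k + 1) * t + 2 * f = (2 * k + 1) * t' + 2 * f'" by (simp_all add: phi_def)
    \<comment> \<open>Elimination of \<open>f\<close>; the linear map has determinant 1.\<close>
    have "2 * ((k + 1) * t + f) = ((2 * k + 1) * t + 2 * f) + t"
      "2 * ((k + 1) * t' + f') = ((2 * k + 1) * t' + 2 * f') + t'" by (simp_all add: algebra_simps)
    then have "t = t'" unfolding eq by simp
    then show "t = t' \<and> f = f'" using eq(1) by simp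
  qed
  show "inj (psi k)"
  proof (rule injI, clarify)
    fix t f t' f' assume "psi k (t, f) = psi k (t', f')"
    then have eq: "(3 * k + 2) * t + 3 * f = (3 * k + 2) * t' + 3 * f'"
      "(5 * k + 2) * t + 5 * f = (5 * k + 2) * t' + 5 * f'" by (simp_all add: psi_def)
    \<comment> \<open>Again \<open>f\<close> is eliminated; here the determinant is 4.\<close>
    have "5 * ((3 * k + 2) * t + 3 * f) = 3 * ((5 * k + 2) * t + 5 * f) + 4 * t"
      "5 * ((3 * k + 2) * t' + 3 * f') = 3 * ((5 * k + 2) * t' + 5 * f') + 4 * t'"
      by (simp_all add: algebra_simps)
    then have "t = t'" unfolding eq by simp
    then show "t = t' \<and> f = f'" using eq(1) by simp
  qed
  show "inj chi" by (rule injI) (auto simp: chi_def split: prod.splits)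
qed

text \<open>Before the last series edge the conductances increase in the order \<open>phi 3\<close>,
  \<open>phi 2\<close>, \<open>phi 1\<close>, \<open>phi 0\<close>, \<open>psi 2\<close>,
  \<open>psi 1\<close>, \<open>psi 0\<close>, \<open>chi\<close>. The tightest case is
  \<open>phi 0\<close> against \<open>psi 2\<close>: the former stays below 7/4 and the latter
  starts there, which is why the cone is half-open.\<close>

lemma moves_disjoint:
  assumes "p \<in> ratio_cone" "q \<in> ratio_cone"
  shows "phi 0 p \<noteq> phi 1 q" "phi 0 p \<noteq> phi 2 q" "phi 0 p \<noteq> phi 3 q"
    "phi 1 p \<noteq> phi 2 q" "phi 1 p \<noteq> phi 3 q" "phi 2 p \<noteq> phi 3 q"
    "psi 0 p \<noteq> psi 1 q" "psi 0 p \<noteq> psi 2 q" "psi 1 p \<noteq> psi 2 q"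
    "phi 0 p \<noteq> psi 0 q" "phi 0 p \<noteq> psi 1 q" "phi 0 p \<noteq> psi 2 q"
    "phi 1 p \<noteq> psi 0 q" "phi 1 p \<noteq> psi 1 q" "phi 1 p \<noteq> psi 2 q"
    "phi 2 p \<noteq> psi 0 q" "phi 2 p \<noteq> psi 1 q" "phi 2 p \<noteq> psi 2 q"
    "phi 3 p \<noteq> psi 0 q" "phi 3 p \<noteq> psi 1 q" "phi 3 p \<noteq> psi 2 q"
    "phi 0 p \<noteq> chi q" "phi 1 p \<noteq> chi q" "phi 2 p \<noteq> chi q" "phi 3 p \<noteq> chi q"
    "psi 0 p \<noteq> chi q" "psi 1 p \<noteq> chi q" "psi 2 p \<noteq> chi q"
  using assms by (cases p; cases q; auto simp: ratio_cone_def phi_def psi_def chi_def)+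

lemma card_image_Un_disjoint:
  assumes "inj g" "finite A" "finite B" "\<And>a b. a \<in> A \<Longrightarrow> b \<in> B \<Longrightarrow> g a \<noteq> b"
  shows "card (g ` A \<union> B) = card A + card B"
proof -
  have "g ` A \<inter> B = {}" using assms(4) by blast
  then show ?thesis
    using assms by (simp add: card_Un_disjoint card_image inj_on_subset)
qed

lemma card_pairs_rec:
  "card (pairs (Suc (Suc (Suc (Suc n))))) = card (pairs (n + 3)) + 2 * card (pairs (n + 2)) +
     3 * card (pairs (n + 1)) + 2 * card (pairs n)"
proof -
  have P: "p \<in> ratio_cone" if "p \<in> pairs m" for p m
    using that pairs_subset_cone by blast
  note fin = finite_pairs finite_UnI finite_imageI
  note dis = moves_disjoint[OF P P] moves_disjoint[OF P P, symmetric]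
  \<comment> \<open>Nesting to the right with a final empty set lets
    \<open>card_image_Un_disjoint\<close> split off one image at a time.\<close>
  have "pairs (Suc (Suc (Suc (Suc n)))) =
     phi 0 ` pairs (n + 3) \<union> (phi 1 ` pairs (n + 2) \<union> (psi 0 ` pairs (n + 2) \<union>
     (phi 2 ` pairs (n + 1) \<union> (psi 1 ` pairs (n + 1) \<union> (chi ` pairs (n + 1) \<union>
     (phi 3 ` pairs n \<union> (psi 2 ` pairs n \<union> {})))))))"
    by (simp add: Un_assoc)
  also have "card \<dots> = card (pairs (n + 3)) + (card (pairs (n + 2)) + (card (pairs (n + 2)) +
     (card (pairs (n + 1)) + (card (pairs (n + 1)) + (card (pairs (n + 1)) +
     (card (pairs n) + (card (pairs n) + card ({} :: (nat \<times> nat) set))))))))"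
    by (subst card_image_Un_disjoint; (intro inj_moves fin finite.emptyI)?;
        (elim UnE imageE emptyE; hypsubst; erule (1) dis)?)+ simp
  finally show ?thesis by simp
qed

text \<open>Here \<open>2.44\<close> is a rational number with \<open>1 + sqrt 2 < 2.44\<close> below the growth rate of the recurrence.\<close>

lemma card_pairs_ge: "(2.44::real) ^ n \<le> 2.44 ^ 3 * real (card (pairs n))"
proof (induction n rule: pairs.induct)
  case (5 n)
  have "(2.44::real) ^ Suc (Suc (Suc (Suc n))) = 2.44 ^ 4 * 2.44 ^ n"
    by (simp add: eval_nat_numeral)
  \<comment> \<open>The left factor is about 35.45, the right one about 35.75.\<close>
  also have "\<dots> \<le> (2.44 ^ 3 + 2 * 2.44 ^ 2 + 3 * 2.44 + 2) * 2.44 ^ n"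
    by (intro mult_right_mono) (simp_all add: power_divide)
  also have "\<dots> = 2.44 ^ (n + 3) + 2 * 2.44 ^ (n + 2) + 3 * 2.44 ^ (n + 1) + 2 * 2.44 ^ n"
    by (simp add: power_add power2_eq_square algebra_simps)
  also have "\<dots> \<le> 2.44 ^ 3 * real (card (pairs (n + 3))) + 2 * (2.44 ^ 3 * real (card (pairs (n + 2)))) +
      3 * (2.44 ^ 3 * real (card (pairs (n + 1)))) + 2 * (2.44 ^ 3 * real (card (pairs n)))"
    using 5 by (intro add_mono mult_left_mono) simp_all
  also have "\<dots> = 2.44 ^ 3 * real (card (pairs (Suc (Suc (Suc (Suc n))))))"
    unfolding card_pairs_rec by (simp add: algebra_simps)
  finally show ?case .
\<comment> \<open>The initial sets have one element each, and the factor \<open>2.44 ^ 3\<close>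
  gives equality at \<open>n = 3\<close>.\<close>
qed (simp_all add: power_divide eval_nat_numeral)

section \<open>Size of the spectra and the final estimate\<close>

text \<open>Comparing spectra by \<open>card\<close> calls for finiteness. Vertex names vary, so
  there are infinitely many graphs, but a spanning tree is given by a set of subsets of
  \<open>V\<close>, which bounds the tree numbers in terms of \<open>n\<close>.\<close>

lemma finite_tree_spectrum_all: "finite (tree_spectrum (graphs_all n))"
proof (rule finite_subset)
  show "tree_spectrum (graphs_all n) \<subseteq> {..2 ^ 2 ^ n}"
  proof
    fix k assume "k \<in> tree_spectrum (graphs_all n)"
    then obtain V :: "nat set" and E where G: "simple_graph (V, E)" "card V = n" "k = \<tau> (V, E)"
      by (auto simp: tree_spectrum_def graphs_all_def)
    then have V: "finite V" and E: "E \<subseteq> Pow V" by (auto simp: simple_graph_def)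
    have "tree_sets V E \<subseteq> Pow (Pow V)" using E by (auto simp: tree_sets_def)
    then have "card (tree_sets V E) \<le> card (Pow (Pow V))" using V by (intro card_mono) auto
    then show "k \<in> {..2 ^ 2 ^ n}"
      using V G by (simp add: num_spanning_trees_eq_card_tree_sets card_Pow)
  qed
qed simp

lemma tree_spectrum_pla_subset: "tree_spectrum (graphs_pla n) \<subseteq> tree_spectrum (graphs_all n)"
  by (auto simp: tree_spectrum_def graphs_pla_def)

lemma card_pairs_le: "card (pairs n) \<le> (card (tree_spectrum (graphs_pla (n + 3))))\<^sup>2"
proof -
  let ?T = "tree_spectrum (graphs_pla (n + 3))"
  have "finite ?T" using finite_subset[OF tree_spectrum_pla_subset finite_tree_spectrum_all] .
  moreover have "inj_on (\<lambda>(t, f). (t, t + f)) (pairs n)" by (auto simp: inj_on_def)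
  moreover have "(\<lambda>(t, f). (t, t + f)) ` pairs n \<subseteq> ?T \<times> ?T"
    using open_net_in_spectrum open_net_pairs by fastforce
  ultimately have "card (pairs n) \<le> card (?T \<times> ?T)"
    by (intro card_inj_on_le[of "\<lambda>(t, f). (t, t + f)"]) auto
  then show ?thesis by (simp add: card_cartesian_product power2_eq_square)
qed

theorem theorem1p1:
  fixes c :: real
  assumes "c = sqrt (sqrt 2 + 1)"
  shows "c \<ge> 1.55 \<and>
    (\<forall>\<^sub>F n in sequentially.
       card (tree_spectrum (graphs_all n)) \<ge> card (tree_spectrum (graphs_pla n)) \<and>
       real (card (tree_spectrum (graphs_pla n))) \<ge> 0.9 * c ^ n)"
proof
  have s: "1.41 \<le> sqrt 2" "sqrt 2 \<le> 1.42"
    by (rule real_le_rsqrt real_le_lsqrt; simp add: power2_eq_square)+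
  have c2: "c\<^sup>2 = sqrt 2 + 1" "0 \<le> c" using assms by simp_all
  show "c \<ge> 1.55"
    unfolding assms by (rule real_le_rsqrt) (use s in \<open>simp add: power2_eq_square\<close>)
  \<comment> \<open>The exponent 6 combines the factor \<open>2.44 ^ 3\<close> of
    \<open>card_pairs_ge\<close> with the shift by three vertices in \<open>pairs\<close>. As
    \<open>1 + sqrt 2 \<le> 2.42\<close>, the gap between 2.42 and 2.44 absorbs it.\<close>
  obtain N where N: "2.44 ^ 6 < (2.44 / 2.42 :: real) ^ N"
    using real_arch_pow[of "2.44 / 2.42 :: real" "2.44 ^ 6"] by auto
  have "\<forall>\<^sub>F n in sequentially. 2.44 ^ 6 \<le> (2.44 / 2.42 :: real) ^ n"
    using eventually_ge_at_top[of N]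
  proof eventually_elim
    case (elim n)
    then have "(2.44 / 2.42 :: real) ^ N \<le> (2.44 / 2.42) ^ n" by (intro power_increasing) simp_all
    then show ?case using N by linarith
  qed
  then show "\<forall>\<^sub>F n in sequentially.
       card (tree_spectrum (graphs_all n)) \<ge> card (tree_spectrum (graphs_pla n)) \<and>
       real (card (tree_spectrum (graphs_pla n))) \<ge> 0.9 * c ^ n"
    using eventually_ge_at_top[of 3]
  proof eventually_elim
    case (elim n)
    let ?T = "card (tree_spectrum (graphs_pla n))"
    \<comment> \<open>Squares are compared because \<open>card_pairs_le\<close> bounds the number of
      pairs by the squared size of the spectrum.\<close>
    have "(0.9 * c ^ n)\<^sup>2 \<le> (c ^ n)\<^sup>2"
      using c2(2) by (intro power_mono) simp_all
    also have "\<dots> = (sqrt 2 + 1) ^ n" 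
      by (simp only: power_mult[symmetric] mult.commute flip: c2(1))
    also have "\<dots> \<le> 2.42 ^ n" using s by (intro power_mono) simp_all
    finally have "2.44 ^ 6 * (0.9 * c ^ n)\<^sup>2 \<le> (2.44 / 2.42) ^ n * (2.42 :: real) ^ n"
      using elim(1) by (intro mult_mono) simp_all
    also have "\<dots> = 2.44 ^ n" by (simp flip: power_mult_distrib)
    also have "\<dots> = 2.44 ^ 3 * 2.44 ^ (n - 3)" using elim(2) by (simp flip: power_add)
    also have "\<dots> \<le> 2.44 ^ 3 * (2.44 ^ 3 * real (card (pairs (n - 3))))"
      by (intro mult_left_mono card_pairs_ge) simp
    also have "\<dots> \<le> 2.44 ^ 6 * (real ?T)\<^sup>2"
    proof -
      have "card (pairs (n - 3)) \<le> ?T\<^sup>2" using card_pairs_le[of "n - 3"] elim(2) by simp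
      then have "real (card (pairs (n - 3))) \<le> (real ?T)\<^sup>2" by (metis of_nat_le_iff of_nat_power)
      then show ?thesis by (simp add: eval_nat_numeral)
    qed
    finally have "(0.9 * c ^ n)\<^sup>2 \<le> (real ?T)\<^sup>2" by simp
    then have "0.9 * c ^ n \<le> real ?T" by (rule power2_le_imp_le) simp
    then show ?case
      using card_mono[OF finite_tree_spectrum_all tree_spectrum_pla_subset] by blast
  qed
qed

end
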